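(* Let $A=(a_1\ \cdots\ a_n)\in\mathbb Z^{1\times n}$ be a matrix of positive integers whose toric ideal $I_A$ is a complete intersection. If some minimal Markov basis of $A$ reduces the distance of the circuits of $A$, then $A$ admits a gluing of the first kind, i.e., there is a permutation $\sigma$ of $\{1,\dots,n\}$ such that for each $k\in\{1,\dots,n-1\}$ there exists $x\in\mathbb N\{a_{\sigma(1)},\dots,a_{\sigma(k)}\}\cap a_{\sigma(k+1)}\mathbb N$ with $x\mathbb Z=\mathbb Z\{a_{\sigma(1)},\dots,a_{\sigma(k)}\}\cap a_{\sigma(k+1)}\mathbb Z$.
   Context: $\mathbb NX$ and $\mathbb ZX$ denote the semigroup and the group generated by a set $X$ of integers. For $z\in\mathbb Z^n$, $z^+,z^-\in\mathbb N^n$ are the unique vectors with disjoint supports and $z=z^+-z^-$; $\|\cdot\|$ is the $1$-norm. The toric ideal is $I_A=\langle x^{u^+}-x^{u^-}:u\in\ker(A)\rangle$; it is a complete intersection if generated by $\dim\ker(A)$ elements. A Markov basis is a set $B\subseteq\ker(A)$ whose binomials $x^{u^+}-x^{u^-}$ generate $I_A$; minimal means no proper subset is a Markov basis. For nonzero $z\in\ker(A)$, $u\in\ker(A)$ reduces the distance of $z$ if there exist $(p,q)\in\{(z^+,z^-),(z^-,z^+)\}$ and $\varepsilon\in\{\pm1\}$ with $p+\varepsilon u\in\mathbb N^n$ and $\|p+\varepsilon u-q\|<\|z\|$; $B$ reduces the distance of $Z$ if each nonzero $z\in Z$ has its distance reduced by some element of $B$. A circuit is a nonzero element of $\ker(A)$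 with support of size exactly two. *)

theory Defs
  imports Main "HOL-Library.Poly_Mapping"
begin

(* Column indices of A are elements of a finite type 'i (n = card (UNIV :: 'i set)).
  Integer vectors are functions 'i \<Rightarrow> int.  Polynomials in k[x_i : i in 'i]
  are ('i \<Rightarrow>\<^sub>0 nat) \<Rightarrow>\<^sub>0 'k (exponent vector to coefficient).*)

definition kerA :: "('i::finite \<Rightarrow> int) \<Rightarrow> ('i \<Rightarrow> int) set" where
  "kerA a = {u. (\<Sum>i\<in>UNIV. a i * u i) = 0}"

definition posp :: "('i \<Rightarrow> int) \<Rightarrow> ('i \<Rightarrow> int)" where
  "posp z = (\<lambda>i. max (z i) 0)"

definition negp :: "('i \<Rightarrow> int) \<Rightarrow> ('i \<Rightarrow> int)" where
  "negp z = (\<lambda>i. max (- z i) 0)"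

definition norm1 :: "('i::finite \<Rightarrow> int) \<Rightarrow> int" where
  "norm1 v = (\<Sum>i\<in>UNIV. \<bar>v i\<bar>)"

definition expo :: "('i::finite \<Rightarrow> int) \<Rightarrow> ('i \<Rightarrow>\<^sub>0 nat)" where
  "expo v = Abs_poly_mapping (\<lambda>i. nat (v i))"

definition mono :: "('i::finite \<Rightarrow> int) \<Rightarrow> (('i \<Rightarrow>\<^sub>0 nat) \<Rightarrow>\<^sub>0 'k::comm_ring_1)" where
  "mono v = Poly_Mapping.single (expo v) 1"

definition binom :: "('i::finite \<Rightarrow> int) \<Rightarrow> (('i \<Rightarrow>\<^sub>0 nat) \<Rightarrow>\<^sub>0 'k::comm_ring_1)" where
  "binom u = mono (posp u) - mono (negp u)"

definition ideal_gen :: "'a::comm_ring_1 set \<Rightarrow> 'a set" where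
  "ideal_gen S = {(\<Sum>f\<in>F. c f * f) | F c. finite F \<and> F \<subseteq> S}"

definition toric_ideal :: "'k::field itself \<Rightarrow> ('i::finite \<Rightarrow> int) \<Rightarrow> (('i \<Rightarrow>\<^sub>0 nat) \<Rightarrow>\<^sub>0 'k) set" where
  "toric_ideal _ a = ideal_gen (binom ` kerA a)"

(* For a 1 x n row of positive integers, dim ker(A) = n - 1.*)
definition complete_intersection :: "'k::field itself \<Rightarrow> ('i::finite \<Rightarrow> int) \<Rightarrow> bool" where
  "complete_intersection K a \<longleftrightarrow>
     (\<exists>gs :: ((('i \<Rightarrow>\<^sub>0 nat) \<Rightarrow>\<^sub>0 'k) list).
        length gs = card (UNIV :: 'i set) - 1 \<and> ideal_gen (set gs) = toric_ideal K a)"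

definition markov_basis :: "'k::field itself \<Rightarrow> ('i::finite \<Rightarrow> int) \<Rightarrow> ('i \<Rightarrow> int) set \<Rightarrow> bool" where
  "markov_basis K a B \<longleftrightarrow> B \<subseteq> kerA a \<and>
     ideal_gen (binom ` B :: ((('i \<Rightarrow>\<^sub>0 nat) \<Rightarrow>\<^sub>0 'k) set)) = toric_ideal K a"

definition minimal_markov_basis :: "'k::field itself \<Rightarrow> ('i::finite \<Rightarrow> int) \<Rightarrow> ('i \<Rightarrow> int) set \<Rightarrow> bool" where
  "minimal_markov_basis K a B \<longleftrightarrow> markov_basis K a B \<and>
     (\<forall>B'. B' \<subset> B \<longrightarrow> \<not> markov_basis K a B')"

definition reduces_distance :: "('i::finite \<Rightarrow> int) \<Rightarrow> ('i \<Rightarrow> int) \<Rightarrow> ('i \<Rightarrow> int) \<Rightarrow> bool" where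
  "reduces_distance a u z \<longleftrightarrow> u \<in> kerA a \<and>
     (\<exists>(p, q) \<in> {(posp z, negp z), (negp z, posp z)}. \<exists>\<epsilon> \<in> {1, -1::int}.
        (\<forall>i. p i + \<epsilon> * u i \<ge> 0) \<and> norm1 (\<lambda>i. p i + \<epsilon> * u i - q i) < norm1 z)"

definition reduces_distance_set :: "('i::finite \<Rightarrow> int) \<Rightarrow> ('i \<Rightarrow> int) set \<Rightarrow> ('i \<Rightarrow> int) set \<Rightarrow> bool" where
  "reduces_distance_set a B Z \<longleftrightarrow> (\<forall>z\<in>Z. z \<noteq> (\<lambda>_. 0) \<longrightarrow> (\<exists>u\<in>B. reduces_distance a u z))"

definition circuits :: "('i::finite \<Rightarrow> int) \<Rightarrow> ('i \<Rightarrow> int) set" where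
  "circuits a = {z \<in> kerA a. z \<noteq> (\<lambda>_. 0) \<and> card {i. z i \<noteq> 0} = 2}"

definition nat_span :: "int set \<Rightarrow> int set" where
  "nat_span X = {(\<Sum>x\<in>X. int (c x) * x) | c. True}"

definition int_span :: "int set \<Rightarrow> int set" where
  "int_span X = {(\<Sum>x\<in>X. c x * x) | c. True}"

definition gluing_first_kind :: "('i::finite \<Rightarrow> int) \<Rightarrow> bool" where
  "gluing_first_kind a \<longleftrightarrow> (\<exists>\<sigma> :: nat \<Rightarrow> 'i. bij_betw \<sigma> {0..<card (UNIV :: 'i set)} UNIV \<and>
     (\<forall>k\<in>{1..<card (UNIV :: 'i set)}. \<exists>x.
        x \<in> nat_span (a ` \<sigma> ` {0..<k}) \<and> x \<in> {a (\<sigma> k) * int m | m. True} \<and>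
        {x * m | m. True} = int_span (a ` \<sigma> ` {0..<k}) \<inter> {a (\<sigma> k) * m | m. True}))"

end

theory Submission
  imports Defs Complex_Main
begin

text \<open>
  Let \<open>B\<close> be the given minimal Markov basis. Counting minimal generators gives \<open>|B| \<le> n - 1\<close>.
  If \<open>Z\<close> is a nonempty proper set of columns, the monomials avoiding \<open>Z\<close> cannot be closed under the
  moves in \<open>B\<close>, so some move meets \<open>Z\<close> with one sign only; enlarging \<open>Z\<close> step by step shows that fewer
  than \<open>|Z|\<close> moves have both signs on \<open>Z\<close>, for every nonempty \<open>Z\<close>.

  A move reducing the distance of the circuit on columns \<open>i, j\<close> has \<open>i\<close> or \<open>j\<close> as the whole support of
  one of its sides, and the norm inequality compares the weights of its endpoints if it is itself a
  circuit. This yields an injection \<open>f\<close> from all columns but one, \<open>r\<close>, into \<open>B\<close> such that \<open>{i}\<close> is one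
  side of \<open>f i\<close>. By the sign count, any proper set \<open>X\<close> of columns containing \<open>r\<close> extends by a column
  \<open>i\<close> with \<open>f i\<close> supported in \<open>X \<union> {i}\<close>. So \<open>B\<close> is triangular in the resulting order of the columns;
  as \<open>B\<close> also spans the kernel lattice, the diagonal entries are the minimal multiples
  required by a gluing of the first kind.
\<close>

subsection \<open>Ideals and linear systems\<close>

text \<open>Over itself, a commutative ring is a module whose submodules are its ideals, so general
  facts about spans give the closure properties of \<open>ideal_gen\<close>.\<close>

lemma module_times: "module ((*) :: 'a::comm_ring_1 \<Rightarrow> 'a \<Rightarrow> 'a)"
  by unfold_locales (auto simp: algebra_simps)

lemma ideal_gen_eq_span: "ideal_gen S = module.span (*) S"
  unfolding ideal_gen_def module.span_explicit[OF module_times] by blast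

lemmas ideal_gen_base = module.span_base[OF module_times, folded ideal_gen_eq_span]
lemmas ideal_gen_zero = module.span_zero[OF module_times, folded ideal_gen_eq_span]
lemmas ideal_gen_add = module.span_add[OF module_times, folded ideal_gen_eq_span]
lemmas ideal_gen_neg = module.span_neg[OF module_times, folded ideal_gen_eq_span]
lemmas ideal_gen_mult = module.span_scale[OF module_times, folded ideal_gen_eq_span]
lemmas ideal_gen_eq_iff = module.span_eq[OF module_times, folded ideal_gen_eq_span]

lemma lookup_expo [simp]: "Poly_Mapping.lookup (expo v) i = nat (v i)"
  unfolding expo_def by (simp add: Abs_poly_mapping_inverse)

text \<open>Gaussian elimination by induction on the equations: \<open>g\<close> is solved for an
  unknown \<open>u0\<close> with nonzero coefficient and substituted into the rest.\<close>

lemma homogeneous_system_nontrivial_solution: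
  fixes Q :: "'u \<Rightarrow> 'g \<Rightarrow> 'k::field"
  assumes "finite G" "finite U" "card G < card U"
  shows "\<exists>x. (\<exists>u\<in>U. x u \<noteq> 0) \<and> (\<forall>g\<in>G. (\<Sum>u\<in>U. x u * Q u g) = 0)"
  using assms
proof (induction G arbitrary: U Q rule: finite_induct)
  case empty
  then show ?case by (intro exI[of _ "\<lambda>_. 1"]) (auto simp: card_gt_0_iff)
next
  case (insert g G)
  show ?case
  proof (cases "\<forall>u\<in>U. Q u g = 0")
    case True
    have "card G < card U" using insert.prems insert.hyps by simp
    from insert.IH[OF insert.prems(1) this, of Q] True show ?thesis by auto
  next
    case False
    then obtain u0 where u0: "u0 \<in> U" "Q u0 g \<noteq> 0" by blast
    define V where "V = U - {u0}"
    have V: "finite V" "card G < card V" "u0 \<notin> V" "U = insert u0 V"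
      using insert.prems insert.hyps u0 by (auto simp: V_def)
    obtain x where x: "\<exists>u\<in>V. x u \<noteq> 0"
      "\<And>h. h \<in> G \<Longrightarrow> (\<Sum>u\<in>V. x u * (Q u h - Q u g / Q u0 g * Q u0 h)) = 0"
      using insert.IH[OF V(1,2), of "\<lambda>u h. Q u h - Q u g / Q u0 g * Q u0 h"] by blast
    define s where "s = (\<Sum>u\<in>V. x u * Q u g)"
    define y where "y = x(u0 := - s / Q u0 g)"
    have sum_y: "(\<Sum>u\<in>U. y u * Q u h) = - s / Q u0 g * Q u0 h + (\<Sum>u\<in>V. x u * Q u h)" for h
    proof -
      have "(\<Sum>u\<in>V. y u * Q u h) = (\<Sum>u\<in>V. x u * Q u h)"
        using V(3) by (intro sum.cong) (auto simp: y_def)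
      then show ?thesis using V by (simp add: y_def)
    qed
    have "(\<Sum>u\<in>U. y u * Q u h) = 0" if "h \<in> insert g G" for h
    proof (cases "h = g")
      case True
      then show ?thesis using u0 by (simp add: sum_y s_def)
    next
      case False
      then have "(\<Sum>u\<in>V. x u * Q u h) - (\<Sum>u\<in>V. x u * Q u g) * (Q u0 h / Q u0 g) = 0"
        using x(2)[of h] that by (simp add: algebra_simps sum_subtractf sum_distrib_left)
      then show ?thesis by (simp add: sum_y s_def)
    qed
    moreover have "\<exists>u\<in>U. y u \<noteq> 0" using x(1) V(3,4) by (auto simp: y_def)
    ultimately show ?thesis by blast
  qed
qed

lemma poly_mapping_sum_monomials:
  "(\<Sum>v\<in>Poly_Mapping.keys p. Poly_Mapping.single v (Poly_Mapping.lookup p v)) = p"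
  by (rule poly_mapping_eqI) (simp add: lookup_sum lookup_single when_def in_keys_iff)

lemma poly_mapping_nat_add_eq_0_iff:
  fixes s t :: "'a \<Rightarrow>\<^sub>0 nat"
  shows "s + t = 0 \<longleftrightarrow> s = 0 \<and> t = 0"
  by (auto simp: poly_mapping_eq_iff lookup_add fun_eq_iff)

text \<open>Exponents are natural numbers, so zero splits only as zero plus zero.\<close>

lemma lookup_mult_zero:
  fixes p q :: "('a \<Rightarrow>\<^sub>0 nat) \<Rightarrow>\<^sub>0 'k::comm_ring_1"
  shows "Poly_Mapping.lookup (p * q) 0 = Poly_Mapping.lookup p 0 * Poly_Mapping.lookup q 0"
proof -
  have "p * q = (\<Sum>s\<in>Poly_Mapping.keys p. Poly_Mapping.single s (Poly_Mapping.lookup p s))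
      * (\<Sum>t\<in>Poly_Mapping.keys q. Poly_Mapping.single t (Poly_Mapping.lookup q t))"
    by (simp add: poly_mapping_sum_monomials)
  then have "Poly_Mapping.lookup (p * q) 0 = (\<Sum>s\<in>Poly_Mapping.keys p. \<Sum>t\<in>Poly_Mapping.keys q.
      (if s = 0 then Poly_Mapping.lookup p s else 0) * (if t = 0 then Poly_Mapping.lookup q t else 0))"
    by (simp add: sum_product mult_single lookup_sum lookup_single when_def
        poly_mapping_nat_add_eq_0_iff) (auto intro!: sum.cong)
  also have "\<dots> = Poly_Mapping.lookup p 0 * Poly_Mapping.lookup q 0"
    by (simp add: sum_product[symmetric] in_keys_iff)
  finally show ?thesis .
qed

subsection \<open>Coefficient sums over classes of monomials\<close>

text \<open>A linear functional that serves as a certificate of non-membership: for suitable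
  \<open>C\<close> it vanishes on the whole ideal.\<close>

definition coeff_sum :: "('a \<Rightarrow>\<^sub>0 nat) set \<Rightarrow> (('a \<Rightarrow>\<^sub>0 nat) \<Rightarrow>\<^sub>0 'k::comm_ring_1) \<Rightarrow> 'k" where
  "coeff_sum C p = (\<Sum>v\<in>Poly_Mapping.keys p. if v \<in> C then Poly_Mapping.lookup p v else 0)"

lemma coeff_sum_superset:
  assumes "finite S" "Poly_Mapping.keys p \<subseteq> S"
  shows "coeff_sum C p = (\<Sum>v\<in>S. if v \<in> C then Poly_Mapping.lookup p v else 0)"
  unfolding coeff_sum_def
  using assms by (intro sum.mono_neutral_left) (auto simp: in_keys_iff)

lemma coeff_sum_add: "coeff_sum C (p + q) = coeff_sum C p + coeff_sum C q"
proof -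
  let ?S = "Poly_Mapping.keys p \<union> Poly_Mapping.keys q"
  have "coeff_sum C (p + q) = (\<Sum>v\<in>?S. if v \<in> C then Poly_Mapping.lookup (p + q) v else 0)"
    by (intro coeff_sum_superset) (auto simp: Poly_Mapping.keys_add)
  moreover have "coeff_sum C p = (\<Sum>v\<in>?S. if v \<in> C then Poly_Mapping.lookup p v else 0)"
    "coeff_sum C q = (\<Sum>v\<in>?S. if v \<in> C then Poly_Mapping.lookup q v else 0)"
    by (intro coeff_sum_superset; auto)+
  ultimately show ?thesis by (simp add: sum.distrib[symmetric] lookup_add if_distrib cong: sum.cong if_cong)
qed

lemma coeff_sum_zero [simp]: "coeff_sum C 0 = 0"
  by (simp add: coeff_sum_def)

lemma coeff_sum_uminus: "coeff_sum C (- p) = - coeff_sum C p"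
  using coeff_sum_add[of C p "- p"] by (simp add: eq_neg_iff_add_eq_0 add.commute)

lemma coeff_sum_diff: "coeff_sum C (p - q) = coeff_sum C p - coeff_sum C q"
  using coeff_sum_add[of C p "- q"] by (simp add: coeff_sum_uminus)

lemma coeff_sum_sum: "coeff_sum C (sum f F) = (\<Sum>x\<in>F. coeff_sum C (f x))"
  by (induction F rule: infinite_finite_induct) (auto simp: coeff_sum_add)

lemma coeff_sum_single: "coeff_sum C (Poly_Mapping.single v c) = (if v \<in> C then c else 0)"
  by (cases "c = 0") (auto simp: coeff_sum_def)

lemma coeff_sum_mult_single:
  "coeff_sum C (h * Poly_Mapping.single s 1) = (\<Sum>t\<in>Poly_Mapping.keys h. if t + s \<in> C then Poly_Mapping.lookup h t else 0)"
proof -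
  have "h * Poly_Mapping.single s 1 = (\<Sum>t\<in>Poly_Mapping.keys h. Poly_Mapping.single t (Poly_Mapping.lookup h t)) * Poly_Mapping.single s 1"
    by (simp add: poly_mapping_sum_monomials)
  also have "\<dots> = (\<Sum>t\<in>Poly_Mapping.keys h. Poly_Mapping.single (t + s) (Poly_Mapping.lookup h t))"
    by (simp add: sum_distrib_right mult_single)
  finally show ?thesis by (simp add: coeff_sum_sum coeff_sum_single)
qed

lemma coeff_sum_mult_binom:
  "coeff_sum C (h * binom u) = (\<Sum>t\<in>Poly_Mapping.keys h. if t + expo (posp u) \<in> C then Poly_Mapping.lookup h t else 0)
     - (\<Sum>t\<in>Poly_Mapping.keys h. if t + expo (negp u) \<in> C then Poly_Mapping.lookup h t else 0)"
  by (simp add: binom_def mono_def algebra_simps coeff_sum_diff coeff_sum_mult_single)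

lemma coeff_sum_binom:
  "coeff_sum C (binom u :: _ \<Rightarrow>\<^sub>0 'k::comm_ring_1)
     = (if expo (posp u) \<in> C then 1 else 0) - (if expo (negp u) \<in> C then 1 else 0)"
  by (simp add: binom_def mono_def coeff_sum_diff coeff_sum_single)

text \<open>In the graph on monomials with an edge for every monomial multiple of a move, these are
  the unions of connected components.\<close>

definition move_closed :: "('i::finite \<Rightarrow> int) set \<Rightarrow> ('i \<Rightarrow>\<^sub>0 nat) set \<Rightarrow> bool" where
  "move_closed B C \<longleftrightarrow> (\<forall>u\<in>B. \<forall>t. t + expo (posp u) \<in> C \<longleftrightarrow> t + expo (negp u) \<in> C)"

lemma coeff_sum_mult_binom_move_closed:
  assumes "move_closed B C" "u \<in> B"
  shows "coeff_sum C (h * binom u) = 0"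
  using assms by (simp add: move_closed_def coeff_sum_mult_binom)

lemma coeff_sum_ideal_gen_move_closed:
  assumes "move_closed B C" "p \<in> ideal_gen (binom ` B)"
  shows "coeff_sum C p = 0"
proof -
  obtain F c where F: "F \<subseteq> binom ` B" "p = (\<Sum>f\<in>F. c f * f)"
    using assms(2) unfolding ideal_gen_def by blast
  show ?thesis unfolding F(2) coeff_sum_sum
    using F(1) coeff_sum_mult_binom_move_closed[OF assms(1)] by (intro sum.neutral) blast
qed

text \<open>The functional of \<open>C\<close> vanishes on the toric ideal. On
  \<open>binom z\<close> it is the difference of two membership indicators, which must therefore
  agree. Each later property of \<open>B\<close> comes from a well-chosen \<open>C\<close>.\<close>

lemma markov_basis_move_closed:
  fixes K :: "'k::field itself"
  assumes "markov_basis K a B" "move_closed B C" "z \<in> kerA a"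
  shows "expo (posp z) \<in> C \<longleftrightarrow> expo (negp z) \<in> C"
proof -
  have "(binom z :: _ \<Rightarrow>\<^sub>0 'k) \<in> ideal_gen (binom ` B)"
    using assms(1,3) ideal_gen_base[of "binom z" "binom ` kerA a"]
    by (auto simp: markov_basis_def toric_ideal_def)
  from coeff_sum_ideal_gen_move_closed[OF assms(2) this] show ?thesis
    by (auto simp: coeff_sum_binom split: if_splits)
qed

inductive move_connected :: "('i::finite \<Rightarrow> int) set \<Rightarrow> ('i \<Rightarrow>\<^sub>0 nat) \<Rightarrow> ('i \<Rightarrow>\<^sub>0 nat) \<Rightarrow> bool"
  for B v where
  refl: "move_connected B v v"
| down: "move_connected B v (t + expo (posp u)) \<Longrightarrow> u \<in> B \<Longrightarrow> move_connected B v (t + expo (negp u))"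
| up: "move_connected B v (t + expo (negp u)) \<Longrightarrow> u \<in> B \<Longrightarrow> move_connected B v (t + expo (posp u))"

text \<open>Along a path the difference telescopes into monomial multiples of binomials of
  \<open>B\<close>, up to sign.\<close>

lemma move_connected_imp_ideal_gen:
  assumes "move_connected B v w"
  shows "(Poly_Mapping.single v 1 - Poly_Mapping.single w 1 :: _ \<Rightarrow>\<^sub>0 'k::comm_ring_1)
    \<in> ideal_gen (binom ` B)"
  using assms
proof induction
  case refl
  then show ?case by (simp add: ideal_gen_zero)
next
  case (down t u)
  have "(Poly_Mapping.single t 1 * binom u :: _ \<Rightarrow>\<^sub>0 'k) \<in> ideal_gen (binom ` B)"
    using down by (intro ideal_gen_mult ideal_gen_base) auto
  from ideal_gen_add[OF down.IH this] show ?case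
    by (simp add: binom_def mono_def algebra_simps mult_single)
next
  case (up t u)
  have "(Poly_Mapping.single t 1 * binom u :: _ \<Rightarrow>\<^sub>0 'k) \<in> ideal_gen (binom ` B)"
    using up by (intro ideal_gen_mult ideal_gen_base) auto
  from ideal_gen_add[OF up.IH ideal_gen_neg[OF this]] show ?case
    by (simp add: binom_def mono_def algebra_simps mult_single)
qed

lemma move_closed_connected: "move_closed B {w. move_connected B v w}"
  unfolding move_closed_def by (auto intro: move_connected.intros)

lemma weighted_degree_expo:
  assumes "u \<in> kerA a"
  shows "(\<Sum>i\<in>UNIV. a i * int (Poly_Mapping.lookup (expo (posp u)) i)) = (\<Sum>i\<in>UNIV. a i * int (Poly_Mapping.lookup (expo (negp u)) i))"
proof -
  have "(\<Sum>i\<in>UNIV. a i * int (Poly_Mapping.lookup (expo (posp u)) i)) - (\<Sum>i\<in>UNIV. a i * int (Poly_Mapping.lookup (expo (negp u)) i))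
    = (\<Sum>i\<in>UNIV. a i * u i)"
    by (auto simp: sum_subtractf[symmetric] posp_def negp_def max_def right_diff_distrib[symmetric] intro!: sum.cong)
  then show ?thesis using assms by (simp add: kerA_def)
qed

text \<open>Kernel vectors give binomials that are homogeneous for the grading with weights
  \<open>a i\<close>, so a component stays in one degree.\<close>

lemma move_connected_weighted_degree:
  assumes "move_connected B v w" "B \<subseteq> kerA a"
  shows "(\<Sum>i\<in>UNIV. a i * int (Poly_Mapping.lookup w i)) = (\<Sum>i\<in>UNIV. a i * int (Poly_Mapping.lookup v i))"
  using assms(1)
proof induction
  case (down t u)
  then show ?case using weighted_degree_expo[of u a] assms(2)
    by (auto simp: lookup_add algebra_simps sum.distrib)
next
  case (up t u)
  then show ?case using weighted_degree_expo[of u a] assms(2)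
    by (auto simp: lookup_add algebra_simps sum.distrib)
qed simp

subsection \<open>The size of a minimal Markov basis\<close>

text \<open>Otherwise the remaining moves would already generate \<open>binom w\<close>, against
  minimality.\<close>

lemma minimal_markov_basis_not_connected:
  fixes K :: "'k::field itself"
  assumes "minimal_markov_basis K a B" "w \<in> B"
  shows "\<not> move_connected (B - {w}) (expo (posp w)) (expo (negp w))"
proof
  assume "move_connected (B - {w}) (expo (posp w)) (expo (negp w))"
  from move_connected_imp_ideal_gen[OF this]
  have "(binom w :: _ \<Rightarrow>\<^sub>0 'k) \<in> ideal_gen (binom ` (B - {w}))"
    by (simp add: binom_def mono_def)
  then have "ideal_gen (binom ` (B - {w}) :: (_ \<Rightarrow>\<^sub>0 'k) set) = ideal_gen (binom ` B)"
    unfolding ideal_gen_eq_iff by (auto intro: ideal_gen_base)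
  then have "markov_basis K a (B - {w})"
    using assms(1) by (auto simp: minimal_markov_basis_def markov_basis_def)
  then show False using assms by (auto simp: minimal_markov_basis_def)
qed

text \<open>
  The moves other than \<open>w\<close> cannot connect the two monomials of \<open>w\<close>, and the class of the first one
  lies in a single weighted degree. Summing coefficients over that class therefore reads off the
  constant term of the cofactor of \<open>w\<close>, which replaces Nakayama's lemma.
\<close>

lemma minimal_markov_basis_dual_functional:
  fixes a :: "'i::finite \<Rightarrow> int" and K :: "'k::field itself"
  assumes pos: "\<forall>i. a i > 0" and B: "minimal_markov_basis K a B" and w: "w \<in> B"
  defines "C \<equiv> {v. move_connected (B - {w}) (expo (posp w)) v}"
  shows "u \<in> B \<Longrightarrow> u \<noteq> w \<Longrightarrow> coeff_sum C (h * binom u) = 0"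
    and "coeff_sum C (h * binom w :: _ \<Rightarrow>\<^sub>0 'k) = Poly_Mapping.lookup h 0"
proof -
  show "u \<in> B \<Longrightarrow> u \<noteq> w \<Longrightarrow> coeff_sum C (h * binom u) = 0"
    unfolding C_def by (rule coeff_sum_mult_binom_move_closed[OF move_closed_connected]) auto
  have ker: "B \<subseteq> kerA a"
    using B by (auto simp: minimal_markov_basis_def markov_basis_def)
  let ?d = "\<lambda>v::'i \<Rightarrow>\<^sub>0 nat. \<Sum>i\<in>UNIV. a i * int (Poly_Mapping.lookup v i)"
  have deg: "?d v = ?d (expo (posp w))" if "v \<in> C" for v
    using move_connected_weighted_degree[of "B - {w}" "expo (posp w)" v a] that ker
    by (auto simp: C_def)
  have zero: "t = 0" if "?d t = 0" for t
  proof (rule poly_mapping_eqI)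
    fix i
    have "\<forall>i\<in>UNIV. a i * int (Poly_Mapping.lookup t i) = 0"
      using that pos by (subst sum_nonneg_eq_0_iff[symmetric]) (auto simp: less_imp_le)
    then show "Poly_Mapping.lookup t i = Poly_Mapping.lookup 0 i" using pos by (metis UNIV_I less_irrefl lookup_zero mult_eq_0_iff of_nat_eq_0_iff)
  qed
  have p: "t + expo (posp w) \<in> C \<longleftrightarrow> t = 0" for t
  proof
    assume "t + expo (posp w) \<in> C"
    from deg[OF this] show "t = 0"
      by (intro zero) (simp add: lookup_add algebra_simps sum.distrib)
  qed (auto simp: C_def intro: move_connected.refl)
  \<comment> \<open>Both monomials of \<open>w\<close> have the same degree, so only
    \<open>t = 0\<close> could occur, and that would connect them.\<close>
  have n: "t + expo (negp w) \<notin> C" for t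
  proof
    assume *: "t + expo (negp w) \<in> C"
    from deg[OF this] weighted_degree_expo[of w a] w ker have "t = 0"
      by (intro zero) (auto simp: lookup_add algebra_simps sum.distrib)
    with * minimal_markov_basis_not_connected[OF B w] show False by (simp add: C_def)
  qed
  show "coeff_sum C (h * binom w :: _ \<Rightarrow>\<^sub>0 'k) = Poly_Mapping.lookup h 0"
    by (simp add: coeff_sum_mult_binom p n in_keys_iff sum.delta)
qed

text \<open>With more moves than generators, the constant terms of the cofactors
  \<open>q u g\<close> satisfy a nontrivial linear relation \<open>x\<close>. The functional dual to
  a move \<open>w\<close> with \<open>x w\<close> nonzero sees only these constant terms, which
  forces \<open>x w = 0\<close>.\<close>

lemma minimal_markov_basis_card_le:
  fixes a :: "'i::finite \<Rightarrow> int" and K :: "'k::field itself"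
  assumes pos: "\<forall>i. a i > 0" and B: "minimal_markov_basis K a B" and ci: "complete_intersection K a"
  shows "finite B \<and> card B \<le> card (UNIV :: 'i set) - 1"
proof (rule ccontr)
  assume neg: "\<not> ?thesis"
  obtain gs :: "(('i \<Rightarrow>\<^sub>0 nat) \<Rightarrow>\<^sub>0 'k) list"
    where gs: "length gs = card (UNIV :: 'i set) - 1" "ideal_gen (set gs) = toric_ideal K a"
    using ci by (auto simp: complete_intersection_def)
  define G where "G = set gs"
  have G: "finite G" "card G \<le> card (UNIV :: 'i set) - 1" "ideal_gen G = toric_ideal K a"
    using gs card_length[of gs] by (auto simp: G_def)
  \<comment> \<open>Finiteness of \<open>B\<close> is not known yet, so the count is made on a
    finite part.\<close>
  have "\<exists>U. U \<subseteq> B \<and> finite U \<and> card G < card U"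
  proof (cases "finite B")
    case True
    then show ?thesis using neg G by (intro exI[of _ B]) auto
  next
    case False
    then show ?thesis
      using infinite_arbitrarily_large[of B "Suc (card G)"] by auto
  qed
  then obtain U where U: "U \<subseteq> B" "finite U" "card G < card U" by blast
  have gen: "ideal_gen (binom ` B) = toric_ideal K a"
    using B by (auto simp: minimal_markov_basis_def markov_basis_def)
  have "\<exists>c. (binom u :: _ \<Rightarrow>\<^sub>0 'k) = (\<Sum>g\<in>G. c g * g)" if "u \<in> U" for u
  proof -
    have "binom u \<in> ideal_gen G"
      using that U(1) unfolding G(3) gen[symmetric] by (intro ideal_gen_base) auto
    then obtain F c where F: "F \<subseteq> G" "binom u = (\<Sum>f\<in>F. c f * f)"
      unfolding ideal_gen_def by blast
    have "(\<Sum>g\<in>G. (if g \<in> F then c g else 0) * g) = (\<Sum>f\<in>F. c f * f)"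
      using F(1) G(1) by (intro sum.mono_neutral_cong_right) auto
    then show ?thesis using F(2) by (intro exI[of _ "\<lambda>g. if g \<in> F then c g else 0"]) simp
  qed
  then obtain q where q: "\<And>u. u \<in> U \<Longrightarrow> (binom u :: _ \<Rightarrow>\<^sub>0 'k) = (\<Sum>g\<in>G. q u g * g)"
    by metis
  obtain x where x: "\<exists>u\<in>U. x u \<noteq> 0" "\<And>g. g \<in> G \<Longrightarrow> (\<Sum>u\<in>U. x u * Poly_Mapping.lookup (q u g) 0) = 0"
    using homogeneous_system_nontrivial_solution[OF G(1) U(2,3), of "\<lambda>u g. Poly_Mapping.lookup (q u g) 0"] by blast
  then obtain w where w: "w \<in> U" "x w \<noteq> 0" by blast
  then have wB: "w \<in> B" using U(1) by blast
  define C where "C = {v. move_connected (B - {w}) (expo (posp w)) v}"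
  note dual = minimal_markov_basis_dual_functional[OF pos B wB, folded C_def]
  have scale: "coeff_sum C (h * p) = Poly_Mapping.lookup h 0 * coeff_sum C p" if "p \<in> toric_ideal K a" for h p
  proof -
    have "p \<in> ideal_gen (binom ` B)" using that gen by simp
    then obtain F c where F: "F \<subseteq> binom ` B" "p = (\<Sum>f\<in>F. c f * f)"
      unfolding ideal_gen_def by blast
    have "coeff_sum C (h * (c f * f)) = Poly_Mapping.lookup h 0 * coeff_sum C (c f * f)" if f: "f \<in> F" for f
    proof -
      obtain u where u: "u \<in> B" "f = binom u" using f F(1) by blast
      have "Poly_Mapping.lookup (h * c f) 0 = Poly_Mapping.lookup h 0 * Poly_Mapping.lookup (c f) 0"
        by (rule lookup_mult_zero)
      then show ?thesis using dual(1)[OF u(1)] dual(2)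
        by (cases "u = w") (simp_all add: u(2) mult.assoc[symmetric])
    qed
    then show ?thesis by (simp add: F(2) sum_distrib_left coeff_sum_sum cong: sum.cong)
  qed
  have val: "coeff_sum C (binom u) = (if u = w then 1 else 0 :: 'k)" if "u \<in> U" for u
    using dual(1)[of u 1] dual(2)[of 1] that U(1) by auto
  have "x w = (\<Sum>u\<in>U. x u * coeff_sum C (binom u))"
    using w(1) U(2) val by (simp add: sum.remove)
  also have "\<dots> = (\<Sum>u\<in>U. x u * (\<Sum>g\<in>G. Poly_Mapping.lookup (q u g) 0 * coeff_sum C g))"
  proof (intro sum.cong arg_cong2[where f = "(*)"])
    fix u assume "u \<in> U"
    show "coeff_sum C (binom u) = (\<Sum>g\<in>G. Poly_Mapping.lookup (q u g) 0 * coeff_sum C g)"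
      unfolding q[OF \<open>u \<in> U\<close>] coeff_sum_sum
      using ideal_gen_base[of _ G] G(3) by (intro sum.cong scale) auto
  qed simp_all
  also have "\<dots> = (\<Sum>g\<in>G. (\<Sum>u\<in>U. x u * Poly_Mapping.lookup (q u g) 0) * coeff_sum C g)"
    unfolding sum_distrib_left sum_distrib_right by (subst sum.swap) (simp add: mult.assoc)
  also have "\<dots> = 0" using x(2) by simp
  finally show False using w(2) by simp
qed

subsection \<open>Sign patterns of a Markov basis\<close>

definition mixed_on :: "('i \<Rightarrow> int) \<Rightarrow> 'i set \<Rightarrow> bool" where
  "mixed_on u Z \<longleftrightarrow> (\<exists>i\<in>Z. u i > 0) \<and> (\<exists>i\<in>Z. u i < 0)"

text \<open>Says that \<open>{i}\<close> is the support of \<open>posp u\<close> or of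
  \<open>negp u\<close>; both signs are allowed because a move may be applied in either
  direction.\<close>

definition pure_at :: "('i \<Rightarrow> int) \<Rightarrow> 'i \<Rightarrow> bool" where
  "pure_at u i \<longleftrightarrow> u i > 0 \<and> (\<forall>k. k \<noteq> i \<longrightarrow> u k \<le> 0) \<or> u i < 0 \<and> (\<forall>k. k \<noteq> i \<longrightarrow> u k \<ge> 0)"

text \<open>A circuit for positive weights, not divided by the gcd of \<open>a i\<close> and
  \<open>a j\<close>; distance reduction is assumed for all circuits, not just primitive
  ones.\<close>

definition pair_circuit :: "('i \<Rightarrow> int) \<Rightarrow> 'i \<Rightarrow> 'i \<Rightarrow> 'i \<Rightarrow> int" where
  "pair_circuit a i j = (\<lambda>k. if k = i then a j else if k = j then - a i else 0)"

lemma pair_circuit_in_kerA: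
  fixes a :: "'i::finite \<Rightarrow> int"
  assumes "i \<noteq> j"
  shows "pair_circuit a i j \<in> kerA a"
proof -
  have "(\<Sum>k\<in>UNIV. a k * pair_circuit a i j k)
      = (\<Sum>k\<in>UNIV. (if k = i then a i * a j else 0) - (if k = j then a j * a i else 0))"
    using assms by (intro sum.cong) (auto simp: pair_circuit_def)
  then show ?thesis by (simp add: kerA_def sum_subtractf mult.commute)
qed

lemma posp_pair_circuit:
  "a i > 0 \<Longrightarrow> a j > 0 \<Longrightarrow> posp (pair_circuit a i j) = (\<lambda>k. if k = i then a j else 0)"
  by (auto simp: posp_def pair_circuit_def fun_eq_iff)

lemma negp_pair_circuit:
  "a i > 0 \<Longrightarrow> a j > 0 \<Longrightarrow> i \<noteq> j \<Longrightarrow> negp (pair_circuit a i j) = (\<lambda>k. if k = j then a i else 0)"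
  by (auto simp: negp_def pair_circuit_def fun_eq_iff)

text \<open>Otherwise the monomials avoiding \<open>Z\<close> form a closed set: a mixed move has a
  variable of \<open>Z\<close> in both monomials, any other leaves \<open>Z\<close> alone. A circuit
  on one column inside and one outside \<open>Z\<close> violates this.\<close>

lemma markov_basis_not_mixed_on:
  fixes K :: "'k::field itself" and a :: "'i::finite \<Rightarrow> int"
  assumes pos: "\<forall>i. a i > 0" and B: "markov_basis K a B" and Z: "Z \<noteq> {}" "Z \<noteq> UNIV"
  shows "\<exists>u\<in>B. \<not> mixed_on u Z \<and> (\<exists>i\<in>Z. u i \<noteq> 0)"
proof (rule ccontr)
  assume "\<not> ?thesis"
  then have split: "mixed_on u Z \<or> (\<forall>i\<in>Z. u i = 0)" if "u \<in> B" for u using that by blast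
  define C where "C = {v :: 'i \<Rightarrow>\<^sub>0 nat. \<forall>i\<in>Z. Poly_Mapping.lookup v i = 0}"
  have "move_closed B C"
    unfolding move_closed_def
  proof (intro ballI allI)
    fix u t assume "u \<in> B"
    from split[OF this] show "t + expo (posp u) \<in> C \<longleftrightarrow> t + expo (negp u) \<in> C"
    proof
      assume "mixed_on u Z"
      then obtain i j where "i \<in> Z" "u i > 0" "j \<in> Z" "u j < 0" by (auto simp: mixed_on_def)
      then have "Poly_Mapping.lookup (t + expo (posp u)) i \<noteq> 0"
        "Poly_Mapping.lookup (t + expo (negp u)) j \<noteq> 0"
        by (simp_all add: lookup_add posp_def negp_def)
      then show ?thesis using \<open>i \<in> Z\<close> \<open>j \<in> Z\<close> by (auto simp: C_def)
    qed (simp add: C_def lookup_add posp_def negp_def)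
  qed
  moreover obtain i j where ij: "i \<in> Z" "j \<notin> Z" using Z by blast
  define z where "z = pair_circuit a i j"
  have "z \<in> kerA a" unfolding z_def using ij by (intro pair_circuit_in_kerA) auto
  ultimately have "expo (posp z) \<in> C \<longleftrightarrow> expo (negp z) \<in> C"
    by (rule markov_basis_move_closed[OF B])
  moreover have "expo (posp z) \<notin> C"
    using ij pos by (auto simp: C_def z_def posp_pair_circuit not_le intro!: bexI[of _ i])
  moreover have "expo (negp z) \<in> C"
    using ij pos by (subst z_def, subst negp_pair_circuit) (auto simp: C_def)
  ultimately show False by simp
qed

text \<open>The monomials whose exponents differ from \<open>negp z\<close> by an integer
  combination of \<open>B\<close> form a closed set; it contains the negative part of
  \<open>z\<close>, hence also the positive one.\<close>

lemma markov_basis_spans_kerA: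
  fixes K :: "'k::field itself" and a :: "'i::finite \<Rightarrow> int"
  assumes B: "markov_basis K a B" and "finite B" and z: "z \<in> kerA a"
  shows "\<exists>c. z = (\<lambda>i. \<Sum>u\<in>B. c u * u i)"
proof -
  define C where "C = {v :: 'i \<Rightarrow>\<^sub>0 nat. \<exists>c. \<forall>i.
    int (Poly_Mapping.lookup v i) - negp z i = (\<Sum>u\<in>B. c u * u i)}"
  have pn: "int (nat (posp u i)) = u i + int (nat (negp u i))" for u :: "'i \<Rightarrow> int" and i
    by (auto simp: posp_def negp_def)
  have shift: "(\<Sum>w\<in>B. (c(u := c u + d)) w * w i) = (\<Sum>w\<in>B. c w * w i) + d * u i"
    if "u \<in> B" for u c d i
    using that \<open>finite B\<close> by (simp add: sum.remove[of B u] algebra_simps)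
  have "move_closed B C"
    unfolding move_closed_def
  proof (intro ballI allI iffI)
    fix u t assume u: "u \<in> B" and "t + expo (posp u) \<in> C"
    then obtain c where c: "\<And>i. int (Poly_Mapping.lookup t i) + int (nat (posp u i)) - negp z i
        = (\<Sum>u\<in>B. c u * u i)"
      by (auto simp: C_def lookup_add)
    have "int (Poly_Mapping.lookup (t + expo (negp u)) i) - negp z i
        = (\<Sum>w\<in>B. (c(u := c u + (-1))) w * w i)" for i
      using c[of i] pn[of u i] shift[OF u, of c "-1" i]
      unfolding lookup_add lookup_expo of_nat_add by linarith
    then show "t + expo (negp u) \<in> C" unfolding C_def by blast
  next
    fix u t assume u: "u \<in> B" and "t + expo (negp u) \<in> C"
    then obtain c where c: "\<And>i. int (Poly_Mapping.lookup t i) + int (nat (negp u i)) - negp z i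
        = (\<Sum>u\<in>B. c u * u i)"
      by (auto simp: C_def lookup_add)
    have "int (Poly_Mapping.lookup (t + expo (posp u)) i) - negp z i
        = (\<Sum>w\<in>B. (c(u := c u + 1)) w * w i)" for i
      using c[of i] pn[of u i] shift[OF u, of c "1" i]
      unfolding lookup_add lookup_expo of_nat_add by linarith
    then show "t + expo (posp u) \<in> C" unfolding C_def by blast
  qed
  from markov_basis_move_closed[OF B this z]
  have "expo (posp z) \<in> C"
    by (auto simp: C_def negp_def intro!: exI[of _ "\<lambda>_. 0"])
  then obtain c where "\<And>i. int (nat (posp z i)) - negp z i = (\<Sum>u\<in>B. c u * u i)"
    by (auto simp: C_def)
  then have "z i = (\<Sum>u\<in>B. c u * u i)" for i
    by (metis (no_types, lifting) add_diff_cancel_right' int_nat_eq max.cobounded2 negp_def pn)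
  then show ?thesis by blast
qed

lemma kerA_sign_change:
  assumes pos: "\<forall>i. a i > 0" and u: "u \<in> kerA a" and i: "u i \<noteq> 0"
  shows "\<exists>j. u i * u j < 0"
proof (rule ccontr)
  assume "\<not> ?thesis"
  then have nn: "0 \<le> u i * u j" for j by (simp add: not_less)
  have "(\<Sum>j\<in>UNIV. a j * (u i * u j)) = u i * (\<Sum>j\<in>UNIV. a j * u j)"
    by (simp add: sum_distrib_left mult_ac)
  also have "\<dots> = 0" using u by (simp add: kerA_def)
  finally have "\<forall>j\<in>UNIV. a j * (u i * u j) = 0"
    using nn pos by (subst (asm) sum_nonneg_eq_0_iff) (auto simp: less_imp_le)
  then have "a i * (u i * u i) = 0" by blast
  then show False using i pos by (metis less_irrefl mult_eq_0_iff)
qed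

text \<open>
  The no-mixed-square-submatrix property of complete intersections: a violating set of columns
  could be enlarged by one column and one mixed row as long as some row of \<open>B\<close> meets it one-sidedly,
  and it never becomes the set of all columns because \<open>B\<close> has too few rows.
\<close>

lemma card_mixed_on_less:
  fixes K :: "'k::field itself" and a :: "'i::finite \<Rightarrow> int"
  assumes pos: "\<forall>i. a i > 0" and B: "markov_basis K a B"
    and fin: "finite B" and card: "card B \<le> card (UNIV :: 'i set) - 1" and "Z \<noteq> {}"
  shows "card {u \<in> B. mixed_on u Z} < card Z"
  using \<open>Z \<noteq> {}\<close>
proof (induction "card (UNIV :: 'i set) - card Z" arbitrary: Z rule: less_induct)
  case less
  show ?case
  proof (rule ccontr)
    assume "\<not> ?thesis"
    then have le: "card Z \<le> card {u \<in> B. mixed_on u Z}" by simp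
    have "card {u \<in> B. mixed_on u Z} \<le> card B" using fin by (intro card_mono) auto
    moreover have "0 < card (UNIV :: 'i set)" by (simp add: card_gt_0_iff)
    ultimately have lt: "card Z < card (UNIV :: 'i set)" using le card by linarith
    then have "Z \<noteq> UNIV" by blast
    then obtain u i where u: "u \<in> B" "\<not> mixed_on u Z" "i \<in> Z" "u i \<noteq> 0"
      using markov_basis_not_mixed_on[OF pos B less.prems] by blast
    have "u \<in> kerA a" using B u by (auto simp: markov_basis_def)
    from kerA_sign_change[OF pos this u(4)] obtain j where j: "u i * u j < 0" by blast
    then have jZ: "j \<notin> Z" using u by (auto simp: mixed_on_def mult_less_0_iff)
    \<comment> \<open>Adding \<open>j\<close> makes the one-sided move \<open>u\<close> mixed and
      keeps the mixed ones mixed, so the violation passes to a larger set.\<close>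
    have "insert u {u \<in> B. mixed_on u Z} \<subseteq> {w \<in> B. mixed_on w (insert j Z)}"
      using u j by (auto simp: mixed_on_def mult_less_0_iff)
    then have "card (insert u {u \<in> B. mixed_on u Z}) \<le> card {w \<in> B. mixed_on w (insert j Z)}"
      using fin by (intro card_mono) auto
    moreover have "card (insert u {u \<in> B. mixed_on u Z}) = Suc (card {u \<in> B. mixed_on u Z})"
      using u fin by simp
    moreover have "card (insert j Z) = Suc (card Z)" using jZ by simp
    moreover have "card {w \<in> B. mixed_on w (insert j Z)} < card (insert j Z)"
      using less.hyps[of "insert j Z"] lt jZ by auto
    ultimately show False using le by linarith
  qed
qed

subsection \<open>Distance reduction of circuits\<close>

text \<open>The two entries have opposite signs, which bounds all others from both sides.\<close>

lemma pure_at_two_imp_zero: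
  assumes "pure_at u i" "pure_at u k" "i \<noteq> k" "l \<noteq> i" "l \<noteq> k"
  shows "u l = 0"
  using assms unfolding pure_at_def by (metis order.antisym order.asym not_less)

text \<open>The start has only column \<open>i\<close> in its support, so no other entry of
  \<open>w\<close> can be negative; and \<open>w = 0\<close> reduces nothing. If \<open>w\<close> is
  a circuit on \<open>i\<close> and \<open>k\<close>, the part \<open>a i\<close> of the norm at
  \<open>j\<close> remains, so the norm drops only if \<open>w k < - w i\<close>; the kernel
  equation turns this into \<open>a i < a k\<close>.\<close>

lemma reducing_vector_pure_at:
  fixes a :: "'i::finite \<Rightarrow> int"
  assumes pos: "\<forall>i. a i > 0" and w: "w \<in> kerA a" and ij: "i \<noteq> j"
    and ge: "\<And>k. (if k = i then a j else 0) + w k \<ge> 0"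
    and less: "norm1 (\<lambda>k. (if k = i then a j else 0) + w k - (if k = j then a i else 0)) < a i + a j"
  shows "pure_at w i" and "k \<noteq> i \<Longrightarrow> k \<noteq> j \<Longrightarrow> pure_at w k \<Longrightarrow> a i < a k"
proof -
  have nn: "w k \<ge> 0" if "k \<noteq> i" for k using ge[of k] that by simp
  have "w i < 0"
  proof (rule ccontr)
    assume "\<not> w i < 0"
    then have "w k \<ge> 0" for k using nn by (cases "k = i") auto
    then have "w k = 0" for k
      using kerA_sign_change[OF pos w, of k] by (metis mult_nonneg_nonneg not_less)
    then have "norm1 (\<lambda>k. (if k = i then a j else 0) + w k - (if k = j then a i else 0))
      = (\<Sum>k\<in>UNIV. (if k = i then a j else 0) + (if k = j then a i else 0))"
      unfolding norm1_def using ij pos by (intro sum.cong) (auto simp: less_imp_le)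
    then show False using less by (simp add: sum.distrib)
  qed
  then show pure: "pure_at w i" using nn by (simp add: pure_at_def)
  assume k: "k \<noteq> i" "k \<noteq> j" "pure_at w k"
  have zero: "w l = 0" if "l \<noteq> i" "l \<noteq> k" for l
    using pure_at_two_imp_zero[OF pure k(3)] k(1) that by auto
  have "norm1 (\<lambda>k. (if k = i then a j else 0) + w k - (if k = j then a i else 0))
      = (\<Sum>l\<in>UNIV. (if l = i then a j + w i else 0) + (if l = k then w k else 0) + (if l = j then a i else 0))"
    unfolding norm1_def using ij k pos ge[of i] nn[of k] zero
    by (intro sum.cong) (auto simp: less_imp_le)
  then have lt: "w k < - w i" using less by (simp add: sum.distrib)
  have "(\<Sum>l\<in>UNIV. a l * w l) = (\<Sum>l\<in>{i, k}. a l * w l)"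
    using zero by (intro sum.mono_neutral_right) auto
  then have eq: "a i * (- w i) = a k * w k" using w k(1) by (simp add: kerA_def)
  show "a i < a k"
  proof (rule ccontr)
    assume "\<not> a i < a k"
    then have "a k * w k \<le> a i * w k" using nn[OF k(1)] by (intro mult_right_mono) auto
    also have "\<dots> < a i * (- w i)" using lt pos by (intro mult_strict_left_mono) auto
    finally show False using eq by simp
  qed
qed

text \<open>The two alternatives come from starting at the positive or the negative part of the
  circuit; the sign of the move does not affect \<open>pure_at\<close>.\<close>

lemma circuit_reduction_pure_at:
  fixes a :: "'i::finite \<Rightarrow> int"
  assumes pos: "\<forall>i. a i > 0" and red: "reduces_distance_set a B (circuits a)" and ij: "i \<noteq> j"
  shows "\<exists>u\<in>B. pure_at u i \<and> (\<forall>k. k \<noteq> i \<and> k \<noteq> j \<and> pure_at u k \<longrightarrow> a i < a k) \<or>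
    pure_at u j \<and> (\<forall>k. k \<noteq> j \<and> k \<noteq> i \<and> pure_at u k \<longrightarrow> a j < a k)"
proof -
  define z where "z = pair_circuit a i j"
  note z_simp = z_def pair_circuit_def
  have supp: "{k. z k \<noteq> 0} = {i, j}" using pos ij by (auto simp: z_simp less_imp_neq[symmetric])
  then have ne: "z \<noteq> (\<lambda>_. 0)" by auto
  have "z \<in> circuits a"
    using pair_circuit_in_kerA[OF ij, of a] ne ij unfolding circuits_def by (simp add: supp z_def[symmetric])
  with ne obtain u where u: "u \<in> B" "reduces_distance a u z"
    using red by (auto simp: reduces_distance_set_def)
  have p: "posp z = (\<lambda>k. if k = i then a j else 0)" and n: "negp z = (\<lambda>k. if k = j then a i else 0)"
    using pos ij by (auto simp: z_def posp_pair_circuit negp_pair_circuit)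
  have "norm1 z = (\<Sum>k\<in>{i, j}. \<bar>z k\<bar>)"
    unfolding norm1_def by (intro sum.mono_neutral_right) (auto simp: z_simp)
  then have norm: "norm1 z = a i + a j" using pos ij by (simp add: z_simp less_imp_le)
  have "\<exists>e\<in>{1, -1::int}.
      (\<forall>k. posp z k + e * u k \<ge> 0) \<and> norm1 (\<lambda>k. posp z k + e * u k - negp z k) < norm1 z \<or>
      (\<forall>k. negp z k + e * u k \<ge> 0) \<and> norm1 (\<lambda>k. negp z k + e * u k - posp z k) < norm1 z"
    using u(2) unfolding reduces_distance_def by auto
  then obtain e where e: "e \<in> {1, -1::int}"
    and or: "(\<forall>k. posp z k + e * u k \<ge> 0) \<and> norm1 (\<lambda>k. posp z k + e * u k - negp z k) < norm1 z \<or>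
      (\<forall>k. negp z k + e * u k \<ge> 0) \<and> norm1 (\<lambda>k. negp z k + e * u k - posp z k) < norm1 z"
    by blast
  have w: "(\<lambda>k. e * u k) \<in> kerA a"
    using u(2) sum_distrib_left[of e "\<lambda>k. a k * u k" UNIV]
    by (simp add: reduces_distance_def kerA_def mult_ac)
  have pe: "pure_at (\<lambda>k. e * u k) k \<longleftrightarrow> pure_at u k" for k
    using e by (auto simp: pure_at_def)
  from or show ?thesis
  proof
    assume *: "(\<forall>k. posp z k + e * u k \<ge> 0) \<and> norm1 (\<lambda>k. posp z k + e * u k - negp z k) < norm1 z"
    show ?thesis
      using reducing_vector_pure_at[OF pos w ij] * u(1) unfolding p n norm pe by blast
  next
    assume *: "(\<forall>k. negp z k + e * u k \<ge> 0) \<and> norm1 (\<lambda>k. negp z k + e * u k - posp z k) < norm1 z"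
    show ?thesis
      using reducing_vector_pure_at[OF pos w ij[symmetric]] * u(1)
      unfolding p n norm pe by (auto simp: add.commute)
  qed
qed

text \<open>
  A vector with singleton support on both sides is assigned to its endpoint of smaller weight
  (ties broken by an enumeration of the indices), so that no vector is assigned twice.
\<close>

lemma circuit_reduction_matching:
  fixes a :: "'i::finite \<Rightarrow> int"
  assumes pos: "\<forall>i. a i > 0" and red: "reduces_distance_set a B (circuits a)"
  shows "\<exists>r f. inj_on f (- {r}) \<and> f ` (- {r}) \<subseteq> B \<and> (\<forall>i. i \<noteq> r \<longrightarrow> pure_at (f i) i)"
proof -
  obtain num :: "'i \<Rightarrow> nat" where num: "inj num"
    using finite_imp_inj_to_nat_seg[of "UNIV :: 'i set"] by auto
  define before where "before i j \<longleftrightarrow> a i < a j \<or> a i = a j \<and> num i < num j" for i j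
  have asym: "\<not> (before i j \<and> before j i)" for i j by (auto simp: before_def)
  have total: "before i j \<or> before j i" if "i \<noteq> j" for i j
    using that inj_eq[OF num, of i j] by (auto simp: before_def neq_iff)
  define good where "good i u \<longleftrightarrow> u \<in> B \<and> pure_at u i \<and> (\<forall>k. k \<noteq> i \<and> pure_at u k \<longrightarrow> before i k)" for i u
  have ordered: "(\<exists>u. good i u) \<or> (\<exists>u. good j u)" if ij: "before i j" for i j
  proof -
    have ne: "i \<noteq> j" using ij asym by blast
    obtain u where "u \<in> B" and u: "pure_at u i \<and> (\<forall>k. k \<noteq> i \<and> k \<noteq> j \<and> pure_at u k \<longrightarrow> a i < a k) \<or>
        pure_at u j \<and> (\<forall>k. k \<noteq> j \<and> k \<noteq> i \<and> pure_at u k \<longrightarrow> a j < a k)"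
      using circuit_reduction_pure_at[OF pos red ne] by blast
    show ?thesis
    proof (cases "pure_at u i \<and> (\<forall>k. k \<noteq> i \<and> k \<noteq> j \<and> pure_at u k \<longrightarrow> a i < a k)")
      case True
      then have "good i u" using \<open>u \<in> B\<close> ij by (auto simp: good_def before_def)
      then show ?thesis by blast
    next
      case False
      with u have uj: "pure_at u j" "\<And>k. k \<noteq> j \<Longrightarrow> k \<noteq> i \<Longrightarrow> pure_at u k \<Longrightarrow> a j < a k" by blast+
      show ?thesis
      \<comment> \<open>A move pure at both columns vanishes elsewhere and goes to the earlier
        column \<open>i\<close>; otherwise it goes to \<open>j\<close>.\<close>
      proof (cases "pure_at u i")
        case True
        have "k = j" if "k \<noteq> i" "pure_at u k" for k
          using pure_at_two_imp_zero[OF True uj(1) ne, of k] that unfolding pure_at_def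
          by (cases "k = j") auto
        then have "good i u" using True \<open>u \<in> B\<close> ij by (auto simp: good_def)
        then show ?thesis by blast
      next
        case False
        then have "good j u" using uj \<open>u \<in> B\<close> by (auto simp: good_def before_def)
        then show ?thesis by blast
      qed
    qed
  qed
  \<comment> \<open>Of any two columns one is good, so at most one column fails.\<close>
  have "\<exists>r. \<forall>i. i \<noteq> r \<longrightarrow> (\<exists>u. good i u)"
    using ordered total by metis
  then obtain r f where f: "\<And>i. i \<noteq> r \<Longrightarrow> good i (f i)" by metis
  have "inj_on f (- {r})"
  proof (rule inj_onI, rule ccontr)
    fix i k assume "i \<in> - {r}" "k \<in> - {r}" "f i = f k" "i \<noteq> k"
    with f[of i] f[of k] have "before i k" "before k i" by (auto simp: good_def)
    then show False using asym by blast
  qed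
  then show ?thesis using f by (intro exI[of _ r] exI[of _ f]) (auto simp: good_def)
qed

subsection \<open>Gluing\<close>

text \<open>Spans are taken over the set of weights, where equal weights coincide; the coefficients
  of columns with equal weight are added.\<close>

lemma nat_span_image:
  assumes "finite X"
  shows "(\<Sum>l\<in>X. int (c l) * a l) \<in> nat_span (a ` X)"
proof -
  have "(\<Sum>l\<in>X. int (c l) * a l) = (\<Sum>x\<in>a ` X. \<Sum>l\<in>{l \<in> X. a l = x}. int (c l) * a l)"
    using assms by (rule sum.image_gen)
  also have "\<dots> = (\<Sum>x\<in>a ` X. int (\<Sum>l\<in>{l \<in> X. a l = x}. c l) * x)"
    by (auto simp: sum_distrib_right intro!: sum.cong)
  finally show ?thesis
    unfolding nat_span_def by (intro CollectI exI[of _ "\<lambda>x. \<Sum>l\<in>{l \<in> X. a l = x}. c l"] conjI TrueI)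
qed

lemma int_span_image:
  assumes "finite X"
  shows "y \<in> int_span (a ` X) \<longleftrightarrow> (\<exists>c. y = (\<Sum>l\<in>X. c l * a l))"
proof
  assume "y \<in> int_span (a ` X)"
  then obtain c where y: "y = (\<Sum>x\<in>a ` X. c x * x)" by (auto simp: int_span_def)
  \<comment> \<open>One column represents each weight; the others get coefficient 0.\<close>
  obtain Y where Y: "Y \<subseteq> X" "inj_on a Y" "a ` X = a ` Y"
    using subset_image_inj[of "a ` X" a X] by auto
  have "y = (\<Sum>l\<in>Y. c (a l) * a l)" using Y by (simp add: y sum.reindex)
  also have "\<dots> = (\<Sum>l\<in>X. (if l \<in> Y then c (a l) else 0) * a l)"
    using Y(1) assms by (intro sum.mono_neutral_cong_left) auto
  finally show "\<exists>c. y = (\<Sum>l\<in>X. c l * a l)"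
    by (intro exI[of _ "\<lambda>l. if l \<in> Y then c (a l) else 0"])
next
  assume "\<exists>c. y = (\<Sum>l\<in>X. c l * a l)"
  then obtain c where "y = (\<Sum>l\<in>X. c l * a l)" by blast
  also have "\<dots> = (\<Sum>x\<in>a ` X. \<Sum>l\<in>{l \<in> X. a l = x}. c l * a l)"
    using assms by (rule sum.image_gen)
  also have "\<dots> = (\<Sum>x\<in>a ` X. (\<Sum>l\<in>{l \<in> X. a l = x}. c l) * x)"
    by (auto simp: sum_distrib_right intro!: sum.cong)
  finally show "y \<in> int_span (a ` X)"
    unfolding int_span_def by (intro CollectI exI[of _ "\<lambda>x. \<Sum>l\<in>{l \<in> X. a l = x}. c l"] conjI TrueI)
qed

lemma greedy_enumeration:
  fixes r :: "'i::finite"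
  assumes ext: "\<And>X. r \<in> X \<Longrightarrow> X \<noteq> UNIV \<Longrightarrow> \<exists>i. i \<notin> X \<and> P X i"
  shows "\<exists>\<sigma>. bij_betw \<sigma> {0..<card (UNIV :: 'i set)} UNIV \<and> \<sigma> 0 = r \<and>
    (\<forall>k\<in>{1..<card (UNIV :: 'i set)}. P (\<sigma> ` {0..<k}) (\<sigma> k))"
proof -
  let ?n = "card (UNIV :: 'i set)"
  have n: "0 < ?n" by (simp add: card_gt_0_iff)
  have "\<exists>\<sigma>. inj_on \<sigma> {0..<Suc m} \<and> \<sigma> 0 = r \<and> (\<forall>k\<in>{1..<Suc m}. P (\<sigma> ` {0..<k}) (\<sigma> k))"
    if "m < ?n" for m
    using that
  proof (induction m)
    case 0
    then show ?case by (intro exI[of _ "\<lambda>_. r"]) auto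
  next
    case (Suc m)
    then obtain \<sigma> where \<sigma>: "inj_on \<sigma> {0..<Suc m}" "\<sigma> 0 = r"
      "\<And>k. k \<in> {1..<Suc m} \<Longrightarrow> P (\<sigma> ` {0..<k}) (\<sigma> k)"
      by auto
    have "card (\<sigma> ` {0..<Suc m}) = Suc m" using \<sigma>(1) by (simp add: card_image)
    then have "\<sigma> ` {0..<Suc m} \<noteq> UNIV" using Suc.prems by auto
    moreover have "r \<in> \<sigma> ` {0..<Suc m}" using \<sigma>(2) by force
    ultimately obtain i where i: "i \<notin> \<sigma> ` {0..<Suc m}" "P (\<sigma> ` {0..<Suc m}) i"
      using ext by blast
    define \<tau> where "\<tau> = \<sigma>(Suc m := i)"
    have img: "\<tau> ` {0..<k} = \<sigma> ` {0..<k}" if "k \<le> Suc m" for k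
      using that by (intro image_cong) (auto simp: \<tau>_def)
    have "inj_on \<tau> {0..<Suc m}" using \<sigma>(1) by (simp add: inj_on_def \<tau>_def)
    then have "inj_on \<tau> {0..<Suc (Suc m)}"
      using i(1) img[of "Suc m"] by (subst atLeast0_lessThan_Suc) (auto simp: \<tau>_def)
    moreover have "P (\<tau> ` {0..<k}) (\<tau> k)" if "k \<in> {1..<Suc (Suc m)}" for k
      using that \<sigma>(3)[of k] i(2) img[of k] by (cases "k = Suc m") (auto simp: \<tau>_def)
    moreover have "\<tau> 0 = r" using \<sigma>(2) by (simp add: \<tau>_def)
    ultimately show ?case by blast
  qed
  from this[of "?n - 1"] n obtain \<sigma> where \<sigma>: "inj_on \<sigma> {0..<?n}" "\<sigma> 0 = r"
    "\<forall>k\<in>{1..<?n}. P (\<sigma> ` {0..<k}) (\<sigma> k)"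
    by auto
  moreover have "\<sigma> ` {0..<?n} = UNIV"
    using \<sigma>(1) by (intro card_subset_eq) (auto simp: card_image)
  ultimately show ?thesis by (auto simp: bij_betw_def)
qed

theorem theorem5p1:
  fixes a :: "'i::finite \<Rightarrow> int" and K :: "'k::field itself"
  assumes "\<forall>i. a i > 0"
    and "complete_intersection K a"
    and "\<exists>B. minimal_markov_basis K a B \<and> reduces_distance_set a B (circuits a)"
  shows "gluing_first_kind a"
proof -
  note pos = assms(1)
  let ?n = "card (UNIV :: 'i set)"
  obtain B where B: "minimal_markov_basis K a B" and red: "reduces_distance_set a B (circuits a)"
    using assms(3) by blast
  then have mb: "markov_basis K a B" and ker: "B \<subseteq> kerA a"
    by (auto simp: minimal_markov_basis_def markov_basis_def)
  have fin: "finite B" and card: "card B \<le> ?n - 1"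
    using minimal_markov_basis_card_le[OF pos B assms(2)] by auto
  obtain r f where inj: "inj_on f (- {r})" and fB: "f ` (- {r}) \<subseteq> B"
    and pure: "\<And>i. i \<noteq> r \<Longrightarrow> pure_at (f i) i"
    using circuit_reduction_matching[OF pos red] by blast
  \<comment> \<open>There are \<open>?n - 1\<close> columns besides \<open>r\<close> and at most as
    many moves, so every move is some \<open>f i\<close>.\<close>
  have surj: "f ` (- {r}) = B"
    using card card_image[OF inj] by (intro card_seteq[OF fin fB]) (simp add: Compl_eq_Diff_UNIV)
  \<comment> \<open>If every \<open>f i\<close> with \<open>i\<close> outside \<open>X\<close> had a
    second nonzero entry there, that entry would have the opposite sign. All these moves would be
    mixed on \<open>- X\<close>, too many for the sign count.\<close>
  have "\<exists>i. i \<notin> X \<and> (\<forall>l. f i l \<noteq> 0 \<longrightarrow> l \<in> insert i X)" if X: "r \<in> X" "X \<noteq> UNIV" for X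
  proof (rule ccontr)
    assume no: "\<not> ?thesis"
    have "f ` (- X) \<subseteq> {u \<in> B. mixed_on u (- X)}"
    proof
      fix u assume "u \<in> f ` (- X)"
      then obtain i where i: "i \<notin> X" "u = f i" by blast
      with no obtain l where l: "f i l \<noteq> 0" "l \<noteq> i" "l \<notin> X" by blast
      have "i \<noteq> r" using i X by blast
      then have "f i i > 0 \<and> f i l < 0 \<or> f i i < 0 \<and> f i l > 0"
        using pure[of i] l(1,2) unfolding pure_at_def by (metis order.order_iff_strict)
      then have "mixed_on u (- X)" using i l(3) unfolding mixed_on_def by blast
      then show "u \<in> {u \<in> B. mixed_on u (- X)}" using fB i \<open>i \<noteq> r\<close> by auto
    qed
    then have "card (f ` (- X)) \<le> card {u \<in> B. mixed_on u (- X)}"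
      using fin by (intro card_mono) auto
    moreover have "card (f ` (- X)) = card (- X)"
      using inj X(1) by (intro card_image inj_on_subset[OF inj]) auto
    ultimately show False
      using card_mixed_on_less[OF pos mb fin card, of "- X"] X by auto
  qed
  from greedy_enumeration[of r "\<lambda>X i. \<forall>l. f i l \<noteq> 0 \<longrightarrow> l \<in> insert i X", OF this]
  obtain \<sigma> where bij: "bij_betw \<sigma> {0..<?n} UNIV" and \<sigma>0: "\<sigma> 0 = r"
    and tri: "\<And>k l. k \<in> {1..<?n} \<Longrightarrow> f (\<sigma> k) l \<noteq> 0 \<Longrightarrow> l \<in> insert (\<sigma> k) (\<sigma> ` {0..<k})"
    by blast
  have n: "0 < ?n" by (simp add: card_gt_0_iff)
  have ne_r: "\<sigma> k \<noteq> r" if "k \<in> {1..<?n}" for k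
    using inj_onD[OF bij_betw_imp_inj_on[OF bij], of k 0] that \<sigma>0 by auto
  have img: "\<sigma> ` {1..<?n} = - {r}"
  proof -
    have "{0..<?n} = insert 0 {1..<?n}" using n by auto
    then have "insert r (\<sigma> ` {1..<?n}) = UNIV" using bij \<sigma>0 by (metis bij_betw_imp_surj_on image_insert)
    then show ?thesis using ne_r by blast
  qed
  have inj\<sigma>: "inj_on \<sigma> {1..<?n}"
    using bij by (auto simp: bij_betw_def intro: inj_on_subset)
  have below: "f (\<sigma> j) (\<sigma> m) = 0" if "j \<in> {1..<?n}" "m \<in> {1..<?n}" "j < m" for j m
  proof (rule ccontr)
    assume "f (\<sigma> j) (\<sigma> m) \<noteq> 0"
    from tri[OF that(1) this] have "\<sigma> m \<in> \<sigma> ` {0..j}" by auto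
    then obtain l where "l \<le> j" "\<sigma> m = \<sigma> l" by auto
    then show False using inj_onD[OF bij_betw_imp_inj_on[OF bij], of m l] that by auto
  qed
  have diag: "f (\<sigma> m) (\<sigma> m) \<noteq> 0" if "m \<in> {1..<?n}" for m
    using pure[OF ne_r[OF that]] by (auto simp: pure_at_def)
  \<comment> \<open>Back substitution: \<open>w\<close> is an integer combination of the triangular
    family. As \<open>w\<close> vanishes on the columns after \<open>k\<close>, the coefficients of
    later moves vanish, from the last one down, and entry \<open>k\<close> is a multiple of the
    diagonal one.\<close>
  have dvd: "f (\<sigma> k) (\<sigma> k) dvd w (\<sigma> k)"
    if k: "k \<in> {1..<?n}" and w: "w \<in> kerA a" and wz: "\<And>m. m \<in> {1..<?n} \<Longrightarrow> k < m \<Longrightarrow> w (\<sigma> m) = 0" for k w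
  proof -
    obtain c where c: "w = (\<lambda>i. \<Sum>u\<in>B. c u * u i)"
      using markov_basis_spans_kerA[OF mb fin w] by blast
    define t where "t j = c (f (\<sigma> j))" for j
    have wt: "w i = (\<Sum>j\<in>{1..<?n}. t j * f (\<sigma> j) i)" for i
    proof -
      have "w i = (\<Sum>u\<in>f ` \<sigma> ` {1..<?n}. c u * u i)" by (simp only: c img surj)
      also have "\<dots> = (\<Sum>j\<in>{1..<?n}. t j * f (\<sigma> j) i)"
        unfolding image_comp
        by (subst sum.reindex[OF comp_inj_on[OF inj\<sigma> inj[folded img]]]) (simp add: t_def)
      finally show ?thesis .
    qed
    have tz: "w (\<sigma> m) = t m * f (\<sigma> m) (\<sigma> m)"
      if m: "m \<in> {1..<?n}" and later: "\<And>j. j \<in> {1..<?n} \<Longrightarrow> m < j \<Longrightarrow> t j = 0" for m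
    proof -
      have "w (\<sigma> m) = (\<Sum>j\<in>{m}. t j * f (\<sigma> j) (\<sigma> m))"
        unfolding wt using m later below
        by (intro sum.mono_neutral_right) (auto simp: neq_iff)
      then show ?thesis by simp
    qed
    have "t m = 0" if "m \<in> {1..<?n}" "k < m" for m
      using that
    proof (induction "?n - m" arbitrary: m rule: less_induct)
      case less
      have "t j = 0" if "j \<in> {1..<?n}" "m < j" for j
        using less.hyps[of j] less.prems that by auto
      then show ?case using tz[OF less.prems(1)] wz[OF less.prems] diag[OF less.prems(1)] by auto
    qed
    then show ?thesis using tz[OF k] by simp
  qed
  show ?thesis
    unfolding gluing_first_kind_def
  proof (intro exI[of _ \<sigma>] conjI ballI bij)
    fix k assume k: "k \<in> {1..<?n}"
    define i where "i = \<sigma> k"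
    define X where "X = \<sigma> ` {0..<k}"
    have iX: "i \<notin> X"
    proof
      assume "i \<in> X"
      then obtain l where "l < k" "\<sigma> k = \<sigma> l" by (auto simp: i_def X_def)
      then show False using inj_onD[OF bij_betw_imp_inj_on[OF bij], of k l] k by auto
    qed
    have "i \<noteq> r" using ne_r[OF k] by (simp add: i_def)
    \<comment> \<open>The sign is normalized to make the diagonal entry positive; the kernel
      equation then writes \<open>a i * u i\<close> with natural coefficients over \<open>X\<close>,
      giving the required \<open>x\<close>.\<close>
    define e where "e = sgn (f i i)"
    define u where "u l = e * f i l" for l
    have u: "u i > 0" "\<And>l. l \<noteq> i \<Longrightarrow> u l \<le> 0" "u i dvd f i i"
      using pure[OF \<open>i \<noteq> r\<close>] by (auto simp: u_def e_def pure_at_def sgn_if)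
    have uz: "u l = 0" if "l \<notin> insert i X" for l
      using tri[OF k, of l] that by (auto simp: u_def i_def X_def)
    have "f i \<in> kerA a" using fB ker \<open>i \<noteq> r\<close> by auto
    then have "(\<Sum>l\<in>UNIV. a l * u l) = 0"
      using sum_distrib_left[of e "\<lambda>l. a l * f i l" UNIV] by (simp add: kerA_def u_def mult_ac)
    moreover have "(\<Sum>l\<in>UNIV. a l * u l) = (\<Sum>l\<in>insert i X. a l * u l)"
      using uz by (intro sum.mono_neutral_right) auto
    ultimately have "a i * u i + (\<Sum>l\<in>X. a l * u l) = 0" using iX by simp
    moreover have "(\<Sum>l\<in>X. int (nat (- u l)) * a l) = (\<Sum>l\<in>X. - (a l * u l))"
    proof (rule sum.cong)
      fix l assume "l \<in> X"
      then have "l \<noteq> i" using iX by blast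
      then have "u l \<le> 0" by (rule u(2))
      then show "int (nat (- u l)) * a l = - (a l * u l)" by simp
    qed simp
    ultimately have x: "a i * u i = (\<Sum>l\<in>X. int (nat (- u l)) * a l)" by (simp add: sum_negf)
    have xspan: "a i * u i \<in> nat_span (a ` X)" unfolding x by (rule nat_span_image) simp
    have "{a i * u i * m | m. True} = int_span (a ` X) \<inter> {a i * m | m. True}"
    proof (intro equalityI subsetI)
      fix y assume "y \<in> {a i * u i * m | m. True}"
      then obtain m where y: "y = a i * u i * m" by blast
      have "y = (\<Sum>l\<in>X. (m * int (nat (- u l))) * a l)"
        unfolding y x by (simp add: sum_distrib_left sum_distrib_right mult_ac)
      then have "y \<in> int_span (a ` X)" by (subst int_span_image) auto
      then show "y \<in> int_span (a ` X) \<inter> {a i * m | m. True}" using y by (auto simp: mult.assoc)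
    next
      fix y assume "y \<in> int_span (a ` X) \<inter> {a i * m | m. True}"
      then obtain m where ym: "y = a i * m" and "y \<in> int_span (a ` X)" by blast
      then obtain b where yb: "y = (\<Sum>l\<in>X. b l * a l)" by (subst (asm) int_span_image) auto
      \<comment> \<open>The common element \<open>y\<close>, written in two ways, becomes a kernel
        vector that vanishes on the columns after \<open>k\<close>, so \<open>dvd\<close> applies to
        its entry \<open>m\<close>.\<close>
      define w where "w l = (if l = i then m else if l \<in> X then - b l else 0)" for l
      have "(\<Sum>l\<in>UNIV. a l * w l) = (\<Sum>l\<in>insert i X. a l * w l)"
        by (intro sum.mono_neutral_right) (auto simp: w_def)
      also have "\<dots> = a i * m + (\<Sum>l\<in>X. - (b l * a l))"
        using iX by (auto simp: w_def intro!: sum.cong)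
      finally have "w \<in> kerA a" using ym yb by (simp add: kerA_def sum_negf)
      moreover have "w (\<sigma> j) = 0" if "j \<in> {1..<?n}" "k < j" for j
      proof -
        have "\<sigma> j \<notin> \<sigma> ` {0..k}"
        proof
          assume "\<sigma> j \<in> \<sigma> ` {0..k}"
          then obtain l where "l \<le> k" "\<sigma> j = \<sigma> l" by auto
          then show False using inj_onD[OF bij_betw_imp_inj_on[OF bij], of j l] that by auto
        qed
        moreover have "insert i X \<subseteq> \<sigma> ` {0..k}" by (auto simp: i_def X_def)
        ultimately have "\<sigma> j \<noteq> i" "\<sigma> j \<notin> X" by blast+
        then show ?thesis by (simp add: w_def)
      qed
      ultimately have "f (\<sigma> k) (\<sigma> k) dvd w (\<sigma> k)" by (rule dvd[OF k])
      then have "f i i dvd m" by (simp add: w_def i_def)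
      with u(3) have "u i dvd m" by (rule dvd_trans)
      then show "y \<in> {a i * u i * m | m. True}" using ym by (auto simp: mult.assoc elim!: dvdE)
    qed
    moreover have "a i * u i = a i * int (nat (u i))" using u(1) by simp
    ultimately show "\<exists>x. x \<in> nat_span (a ` \<sigma> ` {0..<k}) \<and> x \<in> {a (\<sigma> k) * int m | m. True} \<and>
        {x * m | m. True} = int_span (a ` \<sigma> ` {0..<k}) \<inter> {a (\<sigma> k) * m | m. True}"
      using xspan unfolding X_def[symmetric] i_def[symmetric] by (intro exI[of _ "a i * u i"]) blast
  qed
qed

end
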